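(* Let $K\subseteq\mathbb{R}^2$ be a rectangle with side-lengths $0<a\le b$, and let $X=\operatorname{length}(\ell\cap K)$ for a random directed line $\ell$ intersecting $K$ (as defined in the context). Then the probability density function of $X$ is given, for $0<t<\sqrt{a^2+b^2}$, by $$\operatorname{pdf}_X(t)=\frac{1}{a+b}\cdot\begin{cases}1, & \text{if } t<a \text{ and } t<b,\\[4pt] \dfrac{a^2 b}{t^2\sqrt{t^2-a^2}}, & \text{if } a<t<b,\\[8pt] -1+\dfrac{1}{t^2}\left(\dfrac{a^2b}{\sqrt{t^2-a^2}}+\dfrac{ab^2}{\sqrt{t^2-b^2}}\right), & \text{if } t>a \text{ and } t>b.\end{cases}$$
   Context: $K=[0,a]\times[0,b]$. Directed lines $\ell$ in $\mathbb{R}^2$ are parametrized by pairs $(v,q)$, where $v\in\mathbb{S}^{1}$ is the unit direction of $\ell$ and $q$ is the unique point of $\ell$ on the line $v^\perp$ through the origin orthogonal to $v$. Let $d\ell=dA(q)\,dS(v)$, where $dA$ is Lebesgue (length) measure on $v^\perp$ and $dS$ is arc length measure on $\mathbb{S}^1$; this is the translation- and rotation-invariant measure on directed lines, unique up to a constant. Restrict $d\ell$ to the set of directed lines intersecting $K$ and normalize it to a probability measure; $X=\operatorname{length}(\ell\cap K)$ where $\ell$ is random with this law. $\operatorname{pdf}_X$ denotes the probability density function of $X$. *)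

theory Defs
  imports "HOL-Probability.Probability"
begin

text \<open>
  A directed line is a pair \<open>(v, q)\<close> of its unit direction and its foot point on the orthogonal
  complement of \<open>v\<close>.
\<close>

type_synonym point = "real \<times> real"

definition directed_lines :: "(point \<times> point) set" where
  "directed_lines = {(v, q). norm v = 1 \<and> q \<bullet> v = 0}"

definition line_point :: "point \<times> point \<Rightarrow> real \<Rightarrow> point" where
  "line_point l s = snd l + s *\<^sub>R fst l"

definition line_set :: "point \<times> point \<Rightarrow> point set" where
  "line_set l = range (line_point l)"

definition lines_meeting :: "point set \<Rightarrow> (point \<times> point) set" where
  "lines_meeting K = {l \<in> directed_lines. line_set l \<inter> K \<noteq> {}}"

text \<open>
  Arc length on the unit circle and length on the orthogonal complement of a unit vector \<open>v\<close>, as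
  Borel measures on the whole plane concentrated on the respective curve.  Both are images of
  Lebesgue measure under a unit-speed parametrization.
\<close>

definition arc_length :: "point measure" where
  "arc_length = distr (restrict_space lborel {0..<2 * pi}) borel (\<lambda>\<theta>. (cos \<theta>, sin \<theta>))"

definition rot90 :: "point \<Rightarrow> point" where
  "rot90 v = (- snd v, fst v)"

definition orth_length :: "point \<Rightarrow> point measure" where
  "orth_length v = distr lborel borel (\<lambda>p. p *\<^sub>R rot90 v)"

text \<open>
  The measure \<open>dA(q) dS(v)\<close>.  As \<open>q\<close> ranges over a set depending on \<open>v\<close>, it is obtained from a
  product measure by writing \<open>q\<close> as a multiple of \<open>rot90 v\<close>; lemma \<open>emeasure_line_measure\<close> below
  is the iterated-integral description.
\<close>

definition line_measure :: "(point \<times> point) measure" where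
  "line_measure = distr (arc_length \<Otimes>\<^sub>M lborel) borel (\<lambda>(v, p). (v, p *\<^sub>R rot90 v))"

definition random_line :: "point set \<Rightarrow> (point \<times> point) measure" where
  "random_line K = uniform_measure line_measure (lines_meeting K)"

text \<open>
  The length of the part of the line inside \<open>K\<close>; for a directed line, \<open>line_point l\<close> has unit speed.
\<close>

definition chord_length :: "point set \<Rightarrow> point \<times> point \<Rightarrow> real" where
  "chord_length K l = measure lborel {s. line_point l s \<in> K}"

definition rectangle :: "real \<Rightarrow> real \<Rightarrow> point set" where
  "rectangle a b = {0..a} \<times> {0..b}"

lemma emeasure_line_measure:
  assumes A: "A \<in> sets borel"
  shows "emeasure line_measure A = (\<integral>\<^sup>+ v. emeasure (orth_length v) {q. (v, q) \<in> A} \<partial>arc_length)"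
proof -
  have f: "(\<lambda>(v, p). (v, p *\<^sub>R rot90 v)) \<in> arc_length \<Otimes>\<^sub>M lborel \<rightarrow>\<^sub>M (borel :: (point \<times> point) measure)"
  proof -
    have "(\<lambda>(v, p). (v, p *\<^sub>R rot90 v)) \<in> borel \<Otimes>\<^sub>M borel \<rightarrow>\<^sub>M (borel :: (point \<times> point) measure)"
      unfolding borel_prod rot90_def
      by (intro borel_measurable_continuous_onI) (auto simp: case_prod_beta intro!: continuous_intros)
    moreover have "sets (arc_length \<Otimes>\<^sub>M lborel) = sets (borel \<Otimes>\<^sub>M (borel :: real measure))"
      by (intro sets_pair_measure_cong) (auto simp: arc_length_def)
    ultimately show ?thesis
      using measurable_cong_sets by blast
  qed
  have sp: "space arc_length = UNIV"
    by (simp add: arc_length_def)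
  have m: "(\<lambda>p. p *\<^sub>R rot90 v) \<in> lborel \<rightarrow>\<^sub>M (borel :: point measure)" for v
    by (auto intro!: borel_measurable_continuous_onI continuous_intros)
  have sl: "{q. (v, q) \<in> A} \<in> sets borel" for v
  proof -
    have "Pair v \<in> (borel :: point measure) \<rightarrow>\<^sub>M (borel :: (point \<times> point) measure)"
      by (auto intro!: borel_measurable_continuous_onI continuous_intros)
    from measurable_sets[OF this A] show ?thesis by (simp add: vimage_def)
  qed
  have "emeasure line_measure A =
      emeasure (arc_length \<Otimes>\<^sub>M lborel) ((\<lambda>(v, p). (v, p *\<^sub>R rot90 v)) -` A \<inter> space (arc_length \<Otimes>\<^sub>M lborel))"
    unfolding line_measure_def by (rule emeasure_distr[OF f A])
  also have "\<dots> = (\<integral>\<^sup>+ v. emeasure lborel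
      (Pair v -` ((\<lambda>(v, p). (v, p *\<^sub>R rot90 v)) -` A \<inter> space (arc_length \<Otimes>\<^sub>M lborel))) \<partial>arc_length)"
    by (rule lborel.emeasure_pair_measure_alt[OF measurable_sets[OF f A]])
  also have "\<dots> = (\<integral>\<^sup>+ v. emeasure (orth_length v) {q. (v, q) \<in> A} \<partial>arc_length)"
    by (intro nn_integral_cong)
       (simp add: orth_length_def emeasure_distr[OF m sl] space_pair_measure sp vimage_def)
  finally show ?thesis .
qed

end

theory Submission
  imports Defs
begin

text \<open>
  Fix a direction \<open>(cos \<theta>, sin \<theta>)\<close> that is not parallel to a side, and let \<open>p\<close> be the signed
  distance of a line with this direction from the origin.  The line meets the two strips whose
  intersection is the rectangle in two intervals of its parameter, of lengths \<open>a / |cos \<theta>|\<close> and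
  \<open>b / |sin \<theta>|\<close>, and the distance of their midpoints is an affine function of \<open>p\<close> in absolute
  value.  So, for \<open>t \<ge> 0\<close>, the chord is longer than \<open>t\<close> iff \<open>t |cos \<theta>| < a\<close>,
  \<open>t |sin \<theta>| < b\<close>, and \<open>p\<close> lies in an interval of length
  \<open>a |sin \<theta>| + b |cos \<theta>| - 2 t |cos \<theta> sin \<theta>|\<close> (\<open>chord_length_gt_iff\<close>).

  It remains to integrate this length over the circle, that is, four times over a quadrant.  There
  the two side conditions leave the angles between \<open>arccos (a / t)\<close> and \<open>arcsin (b / t)\<close>, with
  quotients above \<open>1\<close> replaced by \<open>1\<close>, and the integrand has an elementary antiderivative.  The
  result is an explicit function \<open>chord_tail a b t\<close> (\<open>quadrant_integral\<close>).  Its value \<open>a + b\<close> at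
  \<open>0\<close> gives the total mass \<open>4 (a + b)\<close> of the lines meeting the rectangle, since lines that touch
  it in a point only are negligible.  Hence the tail probability is \<open>chord_tail a b t / (a + b)\<close>.

  Finally, \<open>chord_tail a b\<close> is continuous, vanishes at the diagonal, and its derivative away from
  \<open>a\<close> and \<open>b\<close> is \<open>- (a + b)\<close> times the claimed density (\<open>chord_tail_derivative\<close>).  The
  fundamental theorem of calculus therefore identifies the tails of both distributions.  Tails
  rather than densities are compared because conditioning on \<open>\<theta>\<close> in general leaves an atom at the
  length of the longest chord in that direction; the atoms are smoothed out only by averaging over \<open>\<theta>\<close>.
\<close>

section \<open>Measurability of the incidence set and of the chord length\<close>

text \<open>
  The foot point of the line with direction \<open>v\<close> through \<open>x\<close> is the projection of \<open>x\<close> to the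
  complement of \<open>v\<close>.  Hence the lines meeting \<open>K\<close> are a continuous image of the product of the
  unit circle with \<open>K\<close>, so they form a set that may be conditioned on.
\<close>

lemma compact_lines_meeting:
  assumes "compact K"
  shows "compact (lines_meeting K)"
proof -
  have "lines_meeting K = (\<lambda>(v, x). (v, x - (x \<bullet> v) *\<^sub>R v)) ` (sphere 0 1 \<times> K)"
  proof (intro equalityI subsetI)
    fix l assume "l \<in> lines_meeting K"
    then obtain s where l: "norm (fst l) = 1" "snd l \<bullet> fst l = 0" "snd l + s *\<^sub>R fst l \<in> K"
      unfolding lines_meeting_def directed_lines_def line_set_def line_point_def by auto
    have "(snd l + s *\<^sub>R fst l) \<bullet> fst l = s"
      using l by (simp add: inner_add_left dot_square_norm)
    then have "l = (\<lambda>(v, x). (v, x - (x \<bullet> v) *\<^sub>R v)) (fst l, snd l + s *\<^sub>R fst l)"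
      by (simp add: prod_eq_iff)
    with l show "l \<in> (\<lambda>(v, x). (v, x - (x \<bullet> v) *\<^sub>R v)) ` (sphere 0 1 \<times> K)"
      by (metis (lifting) SigmaI image_eqI mem_sphere_0)
  next
    fix l assume "l \<in> (\<lambda>(v, x). (v, x - (x \<bullet> v) *\<^sub>R v)) ` (sphere 0 1 \<times> K)"
    then obtain v x where l: "l = (v, x - (x \<bullet> v) *\<^sub>R v)" "norm v = 1" "x \<in> K" by auto
    have "l \<in> directed_lines"
      using l by (simp add: directed_lines_def inner_diff_left dot_square_norm)
    moreover have "line_point l (x \<bullet> v) = x"
      using l by (simp add: line_point_def)
    moreover have "line_point l (x \<bullet> v) \<in> line_set l"
      by (simp add: line_set_def)
    ultimately show "l \<in> lines_meeting K"
      using l(3) unfolding lines_meeting_def by (metis (mono_tags, lifting) IntI empty_iff mem_Collect_eq)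
  qed
  moreover have "continuous_on (sphere 0 1 \<times> K) (\<lambda>(v, x :: point). (v, x - (x \<bullet> v) *\<^sub>R v))"
    by (auto simp: case_prod_beta intro!: continuous_intros)
  ultimately show ?thesis
    using assms by (simp add: compact_Times compact_continuous_image)
qed

lemma sets_lines_meeting:
  assumes "compact K"
  shows "lines_meeting K \<in> sets borel"
  using compact_lines_meeting[OF assms] by (rule borel_compact)

text \<open>
  The chord length is the measure of a section of the set of pairs \<open>(l, s)\<close> with
  \<open>line_point l s \<in> K\<close>, so Tonelli's theorem gives its measurability.
\<close>

lemma measurable_chord_length:
  assumes "K \<in> sets borel"
  shows "chord_length K \<in> borel_measurable borel"
proof -
  have "(\<lambda>(l, s). line_point l s) \<in> (borel :: (point \<times> point) measure) \<Otimes>\<^sub>M lborel \<rightarrow>\<^sub>M borel"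
  proof -
    have "(\<lambda>(l, s). line_point l s) \<in> (borel :: (point \<times> point) measure) \<Otimes>\<^sub>M borel \<rightarrow>\<^sub>M borel"
      unfolding borel_prod line_point_def
      by (intro borel_measurable_continuous_onI) (auto simp: case_prod_beta intro!: continuous_intros)
    then show ?thesis
      by (subst measurable_cong_sets[OF sets_pair_measure_cong[OF refl sets_lborel] refl])
  qed
  from measurable_sets[OF this assms]
  have "(\<lambda>l. emeasure lborel (Pair l -` ((\<lambda>(l, s). line_point l s) -` K \<inter> space (borel \<Otimes>\<^sub>M lborel))))
      \<in> borel_measurable borel"
    by (rule lborel.measurable_emeasure_Pair)
  then have "(\<lambda>l. emeasure lborel {s. line_point l s \<in> K}) \<in> borel_measurable borel"
    by (simp add: space_pair_measure vimage_def)
  then show ?thesis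
    unfolding chord_length_def[abs_def] measure_def by measurable
qed

lemma lines_meeting_if_chord_pos:
  assumes "l \<in> directed_lines" "0 < chord_length K l"
  shows "l \<in> lines_meeting K"
proof (rule ccontr)
  assume "l \<notin> lines_meeting K"
  then have "{s. line_point l s \<in> K} = {}"
    using assms(1) unfolding lines_meeting_def line_set_def by blast
  with assms(2) show False by (simp add: chord_length_def)
qed

section \<open>Lines in polar coordinates\<close>

definition polar_line :: "real \<Rightarrow> real \<Rightarrow> point \<times> point" where
  "polar_line \<theta> p = ((cos \<theta>, sin \<theta>), p *\<^sub>R (- sin \<theta>, cos \<theta>))"

lemma polar_line_in_directed_lines: "polar_line \<theta> p \<in> directed_lines"
  by (simp add: polar_line_def directed_lines_def norm_Pair)

text \<open>
  This turns every probability in question into the integral over the angle of the length of a set of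
  signed distances \<open>p\<close>; both measures in the definition of the line measure are pulled back to
  their parameter intervals.
\<close>

lemma emeasure_line_measure_polar:
  assumes A: "A \<in> sets borel"
  shows "emeasure line_measure A =
      (\<integral>\<^sup>+\<theta>. emeasure lborel {p. polar_line \<theta> p \<in> A} * indicator {0..<2*pi} \<theta> \<partial>lborel)"
proof -
  have f: "(\<lambda>(v, p). (v, p *\<^sub>R rot90 v)) \<in> borel \<Otimes>\<^sub>M lborel \<rightarrow>\<^sub>M (borel :: (point \<times> point) measure)"
  proof -
    have "(\<lambda>(v, p). (v, p *\<^sub>R rot90 v)) \<in> borel \<Otimes>\<^sub>M borel \<rightarrow>\<^sub>M (borel :: (point \<times> point) measure)"
      unfolding borel_prod rot90_def
      by (intro borel_measurable_continuous_onI) (auto simp: case_prod_beta intro!: continuous_intros)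
    then show ?thesis
      by (subst measurable_cong_sets[OF sets_pair_measure_cong[OF refl sets_lborel] refl])
  qed
  have "(\<lambda>v. emeasure lborel (Pair v -` ((\<lambda>(v, p). (v, p *\<^sub>R rot90 v)) -` A \<inter> space (borel \<Otimes>\<^sub>M lborel))))
      \<in> borel_measurable borel"
    by (rule lborel.measurable_emeasure_Pair[OF measurable_sets[OF f A]])
  then have slice: "(\<lambda>v. emeasure lborel {p. (v, p *\<^sub>R rot90 v) \<in> A}) \<in> borel_measurable borel"
    by (simp add: space_pair_measure vimage_def)
  have circle: "(\<lambda>\<theta>. (cos \<theta>, sin \<theta>)) \<in> borel \<rightarrow>\<^sub>M (borel :: point measure)"
    by (intro borel_measurable_continuous_onI) (auto intro!: continuous_intros)
  have orth: "emeasure (orth_length v) {q. (v, q) \<in> A} = emeasure lborel {p. (v, p *\<^sub>R rot90 v) \<in> A}" for v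
  proof -
    have "(\<lambda>p. p *\<^sub>R rot90 v) \<in> lborel \<rightarrow>\<^sub>M (borel :: point measure)"
      by (auto intro!: borel_measurable_continuous_onI continuous_intros)
    moreover have "Pair v \<in> (borel :: point measure) \<rightarrow>\<^sub>M (borel :: (point \<times> point) measure)"
      by (auto intro!: borel_measurable_continuous_onI continuous_intros)
    from measurable_sets[OF this A] have "{q. (v, q) \<in> A} \<in> sets borel"
      by (simp add: vimage_def)
    ultimately show ?thesis
      by (simp add: orth_length_def emeasure_distr vimage_def)
  qed
  have "emeasure line_measure A = (\<integral>\<^sup>+v. emeasure lborel {p. (v, p *\<^sub>R rot90 v) \<in> A} \<partial>arc_length)"
    by (simp add: emeasure_line_measure[OF A] orth)
  also have "\<dots> = (\<integral>\<^sup>+\<theta>. emeasure lborel {p. polar_line \<theta> p \<in> A} \<partial>restrict_space lborel {0..<2*pi})"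
  proof -
    have "(\<lambda>\<theta>. (cos \<theta>, sin \<theta>)) \<in> restrict_space lborel {0..<2*pi} \<rightarrow>\<^sub>M (borel :: point measure)"
      using circle by (intro measurable_restrict_space1) simp
    then show ?thesis
      unfolding arc_length_def using slice
      by (subst nn_integral_distr) (auto simp: polar_line_def rot90_def)
  qed
  also have "\<dots> = (\<integral>\<^sup>+\<theta>. emeasure lborel {p. polar_line \<theta> p \<in> A} * indicator {0..<2*pi} \<theta> \<partial>lborel)"
    by (rule nn_integral_restrict_space) auto
  finally show "emeasure line_measure A = \<dots>" .
qed

section \<open>Chords of a rectangle\<close>

lemma abs_affine_le_iff:
  fixes c :: real
  assumes "c \<noteq> 0"
  shows "\<bar>c * x - y\<bar> \<le> r \<longleftrightarrow> \<bar>x - y / c\<bar> \<le> r / \<bar>c\<bar>"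
proof -
  have "c * x - y = c * (x - y / c)" using assms by (simp add: field_simps)
  then show ?thesis using assms by (simp add: abs_mult pos_le_divide_eq mult.commute)
qed

lemma inter_centred_intervals:
  fixes u w r1 r2 :: real
  shows "{x. \<bar>x - u\<bar> \<le> r1 \<and> \<bar>x - w\<bar> \<le> r2} = {max (u - r1) (w - r2) .. min (u + r1) (w + r2)}"
  by (auto simp: abs_le_iff)

text \<open>
  A rectangle is the intersection of two strips.  Writing each strip condition on the line parameter
  as an interval by its midpoint and radius handles all signs of the direction \<open>(c, s)\<close> at once:
  the signs affect the midpoints only.
\<close>

lemma chord_parameters:
  fixes a b c s p :: real
  assumes "c \<noteq> 0" "s \<noteq> 0"
  shows "{\<sigma>. p *\<^sub>R (-s, c) + \<sigma> *\<^sub>R (c, s) \<in> rectangle a b} =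
    {max ((p * s + a/2) / c - a / (2 * \<bar>c\<bar>)) ((b/2 - p * c) / s - b / (2 * \<bar>s\<bar>)) ..
     min ((p * s + a/2) / c + a / (2 * \<bar>c\<bar>)) ((b/2 - p * c) / s + b / (2 * \<bar>s\<bar>))}"
proof -
  have mid: "0 \<le> z \<and> z \<le> d \<longleftrightarrow> \<bar>z - d/2\<bar> \<le> d/2" for z d :: real
    by linarith
  have c: "0 \<le> \<sigma> * c - p * s \<and> \<sigma> * c - p * s \<le> a \<longleftrightarrow> \<bar>\<sigma> - (p * s + a/2) / c\<bar> \<le> a / 2 / \<bar>c\<bar>" for \<sigma>
    unfolding mid[of "\<sigma> * c - p * s"] abs_affine_le_iff[OF assms(1), symmetric]
    by (simp add: algebra_simps)
  have s: "0 \<le> \<sigma> * s + p * c \<and> \<sigma> * s + p * c \<le> b \<longleftrightarrow> \<bar>\<sigma> - (b/2 - p * c) / s\<bar> \<le> b / 2 / \<bar>s\<bar>" for \<sigma>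
    unfolding mid[of "\<sigma> * s + p * c"] abs_affine_le_iff[OF assms(2), symmetric]
    by (simp add: algebra_simps)
  have "p *\<^sub>R (-s, c) + \<sigma> *\<^sub>R (c, s) \<in> rectangle a b \<longleftrightarrow>
      \<bar>\<sigma> - (p * s + a/2) / c\<bar> \<le> a / 2 / \<bar>c\<bar> \<and> \<bar>\<sigma> - (b/2 - p * c) / s\<bar> \<le> b / 2 / \<bar>s\<bar>" for \<sigma>
    unfolding c[symmetric] s[symmetric] by (auto simp: rectangle_def)
  then show ?thesis
    unfolding inter_centred_intervals[symmetric] divide_divide_eq_left by simp
qed

text \<open>
  Since \<open>(c, s)\<close> is a unit vector, the coefficients of \<open>p\<close> in the two midpoints combine to
  \<open>1 / (c * s)\<close>.  The midpoints agree exactly for the line through the centre of the rectangle.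
\<close>

lemma midpoint_distance:
  fixes a b c s p :: real
  assumes "c \<noteq> 0" "s \<noteq> 0" "c\<^sup>2 + s\<^sup>2 = 1"
  shows "(p * s + a/2) / c - (b/2 - p * c) / s = (p - (b * c - a * s) / 2) / (c * s)"
proof -
  have "(p * s + a/2) / c - (b/2 - p * c) / s = (p * (c\<^sup>2 + s\<^sup>2) - (b * c - a * s) / 2) / (c * s)"
    using assms(1,2) by (simp add: field_simps power2_eq_square)
  then show ?thesis using assms(3) by simp
qed

text \<open>
  The difference of the common ends of two intervals is the least of both lengths and of the sum of
  the radii minus the distance of the midpoints.
\<close>

lemma overlap_gt_iff:
  fixes t u w r1 r2 :: real
  shows "t < min (u + r1) (w + r2) - max (u - r1) (w - r2) \<longleftrightarrow>
    t < 2 * r1 \<and> t < 2 * r2 \<and> \<bar>u - w\<bar> < r1 + r2 - t"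
  by (auto simp: min_def max_def abs_if)

lemma overlap_nonempty_iff:
  fixes u w r1 r2 :: real
  assumes "0 \<le> r1" "0 \<le> r2"
  shows "max (u - r1) (w - r2) \<le> min (u + r1) (w + r2) \<longleftrightarrow> \<bar>u - w\<bar> \<le> r1 + r2"
  using assms by (auto simp: min_def max_def abs_if)

lemma emeasure_abs_less: "emeasure lborel {p. \<bar>p - m\<bar> < (r::real)} = ennreal (2 * r)"
proof -
  have "{p. \<bar>p - m\<bar> < r} = {m - r <..< m + r}" by (auto simp: abs_less_iff)
  then show ?thesis by (cases "0 \<le> r") (auto simp: emeasure_lborel_Ioo ennreal_neg)
qed

lemma emeasure_abs_le: "emeasure lborel {p. \<bar>p - m\<bar> \<le> (r::real)} = ennreal (2 * r)"
proof -
  have "{p. \<bar>p - m\<bar> \<le> r} = {m - r .. m + r}" by (auto simp: abs_le_iff)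
  then show ?thesis by (cases "0 \<le> r") (auto simp: emeasure_lborel_Icc ennreal_neg)
qed

context
  fixes a b \<theta> :: real
  assumes ab: "0 < a" "0 < b" and cs: "cos \<theta> \<noteq> 0" "sin \<theta> \<noteq> 0"
begin

text \<open>
  The first two conditions bound \<open>t\<close> by the longest chord with the given direction; the third
  confines the line to a band around the centre, whose width decreases linearly in \<open>t\<close>.
\<close>

lemma chord_length_gt_iff:
  assumes "0 \<le> t"
  shows "t < chord_length (rectangle a b) (polar_line \<theta> p) \<longleftrightarrow>
    t * \<bar>cos \<theta>\<bar> < a \<and> t * \<bar>sin \<theta>\<bar> < b \<and>
    \<bar>p - (b * cos \<theta> - a * sin \<theta>) / 2\<bar> < (a * \<bar>sin \<theta>\<bar> + b * \<bar>cos \<theta>\<bar>) / 2 - t * \<bar>cos \<theta> * sin \<theta>\<bar>"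
proof -
  let ?c = "cos \<theta>" and ?s = "sin \<theta>"
  define u w r1 r2 where "u = (p * ?s + a/2) / ?c" and "w = (b/2 - p * ?c) / ?s"
    and "r1 = a / (2 * \<bar>?c\<bar>)" and "r2 = b / (2 * \<bar>?s\<bar>)"
  have "t < chord_length (rectangle a b) (polar_line \<theta> p) \<longleftrightarrow>
      t < measure lborel {max (u - r1) (w - r2) .. min (u + r1) (w + r2)}"
    using chord_parameters[OF cs, of p a b]
    by (simp add: chord_length_def polar_line_def line_point_def u_def w_def r1_def r2_def)
  also have "\<dots> \<longleftrightarrow> t < min (u + r1) (w + r2) - max (u - r1) (w - r2)"
    using assms by (auto simp: measure_def emeasure_lborel_Icc_eq)
  also have "\<dots> \<longleftrightarrow> t < 2 * r1 \<and> t < 2 * r2 \<and> \<bar>u - w\<bar> < r1 + r2 - t"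
    by (rule overlap_gt_iff)
  also have "t < 2 * r1 \<longleftrightarrow> t * \<bar>?c\<bar> < a"
    using cs by (simp add: r1_def pos_less_divide_eq)
  also have "t < 2 * r2 \<longleftrightarrow> t * \<bar>?s\<bar> < b"
    using cs by (simp add: r2_def pos_less_divide_eq)
  also have "\<bar>u - w\<bar> < r1 + r2 - t \<longleftrightarrow>
      \<bar>p - (b * ?c - a * ?s) / 2\<bar> < (r1 + r2 - t) * \<bar>?c * ?s\<bar>"
    unfolding u_def w_def midpoint_distance[OF cs sin_cos_squared_add2] abs_divide
    using cs by (subst pos_divide_less_eq) auto
  also have "(r1 + r2 - t) * \<bar>?c * ?s\<bar> = (a * \<bar>?s\<bar> + b * \<bar>?c\<bar>) / 2 - t * \<bar>?c * ?s\<bar>"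
    using cs by (simp add: r1_def r2_def abs_mult field_simps)
  finally show ?thesis .
qed

text \<open>
  Compared with chords of positive length, only the two lines through a single corner are
  added, at the ends of the interval.
\<close>

lemma polar_line_meets_rectangle_iff:
  "polar_line \<theta> p \<in> lines_meeting (rectangle a b) \<longleftrightarrow>
    \<bar>p - (b * cos \<theta> - a * sin \<theta>) / 2\<bar> \<le> (a * \<bar>sin \<theta>\<bar> + b * \<bar>cos \<theta>\<bar>) / 2"
proof -
  let ?c = "cos \<theta>" and ?s = "sin \<theta>"
  define u w r1 r2 where "u = (p * ?s + a/2) / ?c" and "w = (b/2 - p * ?c) / ?s"
    and "r1 = a / (2 * \<bar>?c\<bar>)" and "r2 = b / (2 * \<bar>?s\<bar>)"
  have r: "0 \<le> r1" "0 \<le> r2" using ab by (auto simp: r1_def r2_def)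
  have "polar_line \<theta> p \<in> lines_meeting (rectangle a b) \<longleftrightarrow>
      {\<sigma>. line_point (polar_line \<theta> p) \<sigma> \<in> rectangle a b} \<noteq> {}"
    unfolding lines_meeting_def line_set_def using polar_line_in_directed_lines[of \<theta> p] by blast
  also have "\<dots> \<longleftrightarrow> max (u - r1) (w - r2) \<le> min (u + r1) (w + r2)"
    unfolding polar_line_def line_point_def fst_conv snd_conv chord_parameters[OF cs]
    by (simp only: u_def w_def r1_def r2_def atLeastatMost_empty_iff2 not_le not_less atLeastatMost_empty_iff simp_thms)
  also have "\<dots> \<longleftrightarrow> \<bar>u - w\<bar> \<le> r1 + r2"
    by (rule overlap_nonempty_iff[OF r])
  also have "\<dots> \<longleftrightarrow> \<bar>p - (b * ?c - a * ?s) / 2\<bar> \<le> (r1 + r2) * \<bar>?c * ?s\<bar>"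
    unfolding u_def w_def midpoint_distance[OF cs sin_cos_squared_add2] abs_divide
    using cs by (subst pos_divide_le_eq) auto
  also have "(r1 + r2) * \<bar>?c * ?s\<bar> = (a * \<bar>?s\<bar> + b * \<bar>?c\<bar>) / 2"
    using cs by (simp add: r1_def r2_def abs_mult field_simps)
  finally show ?thesis .
qed

lemma emeasure_long_chords_slice:
  assumes "0 \<le> t"
  shows "emeasure lborel {p. t < chord_length (rectangle a b) (polar_line \<theta> p)} =
    (if t * \<bar>cos \<theta>\<bar> < a \<and> t * \<bar>sin \<theta>\<bar> < b
     then ennreal (a * \<bar>sin \<theta>\<bar> + b * \<bar>cos \<theta>\<bar> - 2 * t * \<bar>cos \<theta>\<bar> * \<bar>sin \<theta>\<bar>) else 0)"
proof (cases "t * \<bar>cos \<theta>\<bar> < a \<and> t * \<bar>sin \<theta>\<bar> < b")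
  case True
  have double: "2 * (x / 2 - y) = x - 2 * y" for x y :: real by simp
  from True show ?thesis
    unfolding chord_length_gt_iff[OF assms]
    by (simp only: simp_thms if_True emeasure_abs_less double abs_mult mult.assoc)
next
  case False
  then have "{p. t < chord_length (rectangle a b) (polar_line \<theta> p)} = {}"
    unfolding chord_length_gt_iff[OF assms] by blast
  with False show ?thesis by (simp only: if_False emeasure_empty)
qed

lemma emeasure_lines_meeting_slice:
  "emeasure lborel {p. polar_line \<theta> p \<in> lines_meeting (rectangle a b)} =
    ennreal (a * \<bar>sin \<theta>\<bar> + b * \<bar>cos \<theta>\<bar>)"
proof -
  have double: "2 * (x / 2) = x" for x :: real by simp
  show ?thesis
    by (simp only: polar_line_meets_rectangle_iff emeasure_abs_le double)
qed

end


section \<open>Integration over the directions\<close>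

lemma nn_integral_reflect:
  fixes f :: "real \<Rightarrow> ennreal"
  assumes [measurable]: "f \<in> borel_measurable borel"
  shows "(\<integral>\<^sup>+x. f (m - x) \<partial>lborel) = (\<integral>\<^sup>+x. f x \<partial>lborel)"
  using nn_integral_real_affine[OF assms, of "-1" m] by simp

text \<open>
  The two reflections generate the symmetry group of a rectangle, which permutes the four quadrants
  simply transitively.
\<close>

lemma nn_integral_circle_eq_quadrant:
  fixes g :: "real \<Rightarrow> ennreal"
  assumes g [measurable]: "g \<in> borel_measurable borel"
    and flip: "\<And>\<theta>. g (pi - \<theta>) = g \<theta>" "\<And>\<theta>. g (2 * pi - \<theta>) = g \<theta>"
  shows "(\<integral>\<^sup>+\<theta>. g \<theta> * indicator {0..<2*pi} \<theta> \<partial>lborel) =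
    4 * (\<integral>\<^sup>+\<theta>. g \<theta> * indicator {0<..<pi/2} \<theta> \<partial>lborel)"
proof -
  define half where "half \<theta> = g \<theta> * indicator {0<..<pi} \<theta>" for \<theta>
  define quad where "quad \<theta> = g \<theta> * indicator {0<..<pi/2} \<theta>" for \<theta>
  have half [measurable]: "half \<in> borel_measurable borel"
    and quad [measurable]: "quad \<in> borel_measurable borel"
    unfolding half_def[abs_def] quad_def[abs_def] by measurable
  have "AE \<theta> in lborel. \<theta> \<notin> {0, pi}"
    by (intro AE_not_in finite_imp_null_set_lborel) auto
  then have "AE \<theta> in lborel. g \<theta> * indicator {0..<2*pi} \<theta> = half \<theta> + half (2 * pi - \<theta>)"
  proof eventually_elim
    case (elim \<theta>)
    consider "\<theta> < 0" | "0 < \<theta>" "\<theta> < pi" | "pi < \<theta>" "\<theta> < 2 * pi" | "2 * pi \<le> \<theta>"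
      using elim pi_gt_zero by (simp only: insert_iff empty_iff de_Morgan_disj) linarith
    then show ?case
      unfolding half_def flip(2) by cases simp_all
  qed
  then have "(\<integral>\<^sup>+\<theta>. g \<theta> * indicator {0..<2*pi} \<theta> \<partial>lborel) =
      (\<integral>\<^sup>+\<theta>. half \<theta> + half (2 * pi - \<theta>) \<partial>lborel)"
    by (rule nn_integral_cong_AE)
  also have "\<dots> = 2 * (\<integral>\<^sup>+\<theta>. half \<theta> \<partial>lborel)"
    by (subst nn_integral_add) (simp_all only: nn_integral_reflect[OF half] mult_2[where 'a = ennreal], measurable)
  also have "(\<integral>\<^sup>+\<theta>. half \<theta> \<partial>lborel) = (\<integral>\<^sup>+\<theta>. quad \<theta> + quad (pi - \<theta>) \<partial>lborel)"
  proof (rule nn_integral_cong_AE)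
    have "AE \<theta> in lborel. \<theta> \<notin> {pi/2}"
      by (intro AE_not_in finite_imp_null_set_lborel) auto
    then show "AE \<theta> in lborel. half \<theta> = quad \<theta> + quad (pi - \<theta>)"
    proof eventually_elim
      case (elim \<theta>)
      consider "\<theta> \<le> 0" | "0 < \<theta>" "\<theta> < pi/2" | "pi/2 < \<theta>" "\<theta> < pi" | "pi \<le> \<theta>"
        using elim pi_gt_zero by (simp only: insert_iff empty_iff de_Morgan_disj) linarith
      then show ?case
        unfolding half_def quad_def flip(1) by cases simp_all
    qed
  qed
  also have "\<dots> = 2 * (\<integral>\<^sup>+\<theta>. quad \<theta> \<partial>lborel)"
    by (subst nn_integral_add) (simp_all only: nn_integral_reflect[OF quad] mult_2[where 'a = ennreal], measurable)
  finally show ?thesis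
    by (simp add: quad_def[abs_def] mult.assoc[symmetric])
qed

text \<open>
  Directions parallel to a side are negligible, so one may divide by both direction cosines.
\<close>

lemma cos_sin_nonzero_ae: "AE \<theta>::real in lborel. cos \<theta> \<noteq> 0 \<and> sin \<theta> \<noteq> 0"
proof -
  have "countable (range (\<lambda>i::int. of_int i * (pi/2)))"
    by simp
  then have "AE \<theta> in lborel. \<theta> \<notin> range (\<lambda>i::int. of_int i * (pi/2))"
    by (intro AE_not_in countable_imp_null_set_lborel)
  then show "AE \<theta>::real in lborel. cos \<theta> \<noteq> 0 \<and> sin \<theta> \<noteq> 0"
  proof eventually_elim
    case (elim \<theta>)
    then have "\<theta> \<noteq> of_int i * (pi/2)" for i :: int
      by blast
    then show ?case
      unfolding cos_zero_iff_int sin_zero_iff_int by blast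
  qed
qed

text \<open>
  This is the integral of \<open>a sin \<theta> + b cos \<theta> - 2 t cos \<theta> sin \<theta>\<close> over the
  directions in the first quadrant that admit a chord longer than \<open>t\<close>, for \<open>t\<close> between \<open>0\<close>
  and the diagonal.  The
  truncations by \<open>max\<close> merge the ranges \<open>t \<le> a\<close>, \<open>a \<le> t \<le> b\<close> and \<open>b \<le> t\<close> into
  one term that is visibly continuous at \<open>a\<close> and \<open>b\<close>.  The denominator is \<open>max a t\<close>
  rather than \<open>t\<close> for continuity at \<open>0\<close>; for \<open>t \<le> a\<close> its numerator vanishes.
\<close>

definition chord_tail :: "real \<Rightarrow> real \<Rightarrow> real \<Rightarrow> real" where
  "chord_tail a b t = max a t + max b t - t -
    (b * sqrt (max 0 (t\<^sup>2 - a\<^sup>2)) + a * sqrt (max 0 (t\<^sup>2 - b\<^sup>2))) / max a t"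

context
  fixes a b :: real
  assumes ab: "0 < a" "a \<le> b"
begin

lemma chord_tail_0: "chord_tail a b 0 = a + b"
  using ab by (simp add: chord_tail_def)

lemma chord_tail_diagonal: "chord_tail a b (sqrt (a\<^sup>2 + b\<^sup>2)) = 0"
proof -
  define d where "d = sqrt (a\<^sup>2 + b\<^sup>2)"
  have d: "d\<^sup>2 = a\<^sup>2 + b\<^sup>2" "0 < d" using ab by (simp_all add: d_def add_pos_pos)
  have "a \<le> d" "b \<le> d" using ab by (auto simp: d_def intro!: real_le_rsqrt)
  have roots: "sqrt (max 0 (d\<^sup>2 - a\<^sup>2)) = b" "sqrt (max 0 (d\<^sup>2 - b\<^sup>2)) = a"
    unfolding d(1) using ab by (simp_all add: max_absorb2)
  have "b * b + a * a = d * d"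
    using d(1) by (simp add: power2_eq_square)
  then have "(b * b + a * a) / max a d = d"
    using \<open>a \<le> d\<close> \<open>0 < d\<close> by (simp add: max_absorb2)
  then show ?thesis
    unfolding chord_tail_def d_def[symmetric] roots using \<open>a \<le> d\<close> \<open>b \<le> d\<close> by linarith
qed

text \<open>
  The inequalities \<open>t cos \<theta> < a\<close> and \<open>t sin \<theta> < b\<close> cut out an interval of angles, which
  shrinks to a point when \<open>t\<close> reaches the diagonal.  The integrand has the antiderivative
  \<open>- a cos \<theta> + b sin \<theta> - t (sin \<theta>)\<^sup>2\<close>, and at the ends of the interval sine and cosine are
  algebraic in \<open>t\<close>.
\<close>

lemma quadrant_integral:
  assumes t: "0 \<le> t" "t \<le> sqrt (a\<^sup>2 + b\<^sup>2)"
  shows "(\<integral>\<^sup>+\<theta>. (if t * cos \<theta> < a \<and> t * sin \<theta> < b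
      then ennreal (a * sin \<theta> + b * cos \<theta> - 2 * t * cos \<theta> * sin \<theta>) else 0)
      * indicator {0<..<pi/2} \<theta> \<partial>lborel) = ennreal (chord_tail a b t)" (is "?L = _")
proof -
  \<comment> \<open>The cosine of the smallest and the sine of the largest admissible angle; \<open>max\<close> caps them at \<open>1\<close>.\<close>
  define c1 s2 where "c1 = a / max a t" and "s2 = b / max b t"
  have c1: "0 < c1" "c1 \<le> 1" and s2: "0 < s2" "s2 \<le> 1"
    unfolding c1_def s2_def using ab by (simp_all add: less_max_iff_disj)
  define \<alpha> \<beta> where "\<alpha> = arccos c1" and "\<beta> = arcsin s2"
  have cs1: "cos \<alpha> = c1" "sin \<alpha> = sqrt (1 - c1\<^sup>2)"
    using c1 by (auto simp: \<alpha>_def sin_arccos)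
  have cs2: "sin \<beta> = s2" "cos \<beta> = sqrt (1 - s2\<^sup>2)"
    using s2 by (auto simp: \<beta>_def cos_arcsin)
  have range: "0 \<le> \<alpha>" "\<alpha> \<le> pi/2" "0 \<le> \<beta>" "\<beta> \<le> pi/2"
    unfolding \<alpha>_def \<beta>_def using c1 s2
    by (intro arccos_lbound arccos_le_pi2 arcsin_ubound arcsin_nonneg; simp)+
  have t2: "t\<^sup>2 \<le> a\<^sup>2 + b\<^sup>2"
    using power_mono[OF t(2,1), of 2] by simp
  have "cos \<beta> \<le> cos \<alpha>"
  proof (cases "t \<le> b")
    case True
    then show ?thesis using ab c1 by (simp add: cs1 cs2 s2_def max_def)
  next
    case False
    then have "0 < t\<^sup>2" and max: "max a t = t" "max b t = t"
      using ab by auto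
    then have "1 \<le> (a\<^sup>2 + b\<^sup>2) / t\<^sup>2"
      using t2 by (simp only: le_divide_eq_1_pos)
    then have "1 - s2\<^sup>2 \<le> c1\<^sup>2"
      unfolding c1_def s2_def max power_divide add_divide_distrib by linarith
    then show ?thesis
      using c1 by (simp add: cs1 cs2 real_le_lsqrt)
  qed
  then have le: "\<alpha> \<le> \<beta>"
    using range by (subst (asm) cos_mono_le_eq) auto
  have c_iff: "t * cos \<theta> < a \<longleftrightarrow> \<alpha> < \<theta>" and s_iff: "t * sin \<theta> < b \<longleftrightarrow> \<theta> < \<beta>"
    if \<theta>: "0 < \<theta>" "\<theta> < pi/2" for \<theta>
  proof -
    have c: "0 < cos \<theta>" "cos \<theta> < 1" and s: "0 < sin \<theta>" "sin \<theta> < 1"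
      using \<theta> cos_mono_less_eq[of \<theta> 0] sin_mono_less_eq[of \<theta> "pi/2"]
      by (auto simp: cos_gt_zero sin_gt_zero)
    \<comment> \<open>For \<open>t < d\<close> both sides hold, because \<open>x < 1\<close>.\<close>
    have cut: "t * x < d \<longleftrightarrow> max d t * x < d" if "0 < x" "x < 1" "0 < d" for x d
      using mult_left_mono[of x 1 t] mult_strict_left_mono[of x 1 d] t(1) that by (auto simp: max_def)
    have "t * cos \<theta> < a \<longleftrightarrow> max a t * cos \<theta> < a"
      using ab c by (intro cut) auto
    also have "\<dots> \<longleftrightarrow> cos \<theta> < cos \<alpha>"
      using ab by (simp add: cs1 c1_def pos_less_divide_eq mult.commute less_max_iff_disj)
    also have "\<dots> \<longleftrightarrow> \<alpha> < \<theta>"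
      using \<theta> range by (intro cos_mono_less_eq) auto
    finally show "t * cos \<theta> < a \<longleftrightarrow> \<alpha> < \<theta>" .
    have "t * sin \<theta> < b \<longleftrightarrow> max b t * sin \<theta> < b"
      using ab s by (intro cut) auto
    also have "\<dots> \<longleftrightarrow> sin \<theta> < sin \<beta>"
      using ab by (simp add: cs2 s2_def pos_less_divide_eq mult.commute less_max_iff_disj)
    also have "\<dots> \<longleftrightarrow> \<theta> < \<beta>"
      using \<theta> range by (intro sin_mono_less_eq) auto
    finally show "t * sin \<theta> < b \<longleftrightarrow> \<theta> < \<beta>" .
  qed
  have "AE \<theta> in lborel. \<theta> \<notin> {\<alpha>, \<beta>}"
    by (intro AE_not_in finite_imp_null_set_lborel) auto
  then have "AE \<theta> in lborel. (if t * cos \<theta> < a \<and> t * sin \<theta> < b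
      then ennreal (a * sin \<theta> + b * cos \<theta> - 2 * t * cos \<theta> * sin \<theta>) else 0) * indicator {0<..<pi/2} \<theta>
      = ennreal (a * sin \<theta> + b * cos \<theta> - 2 * t * cos \<theta> * sin \<theta>) * indicator {\<alpha>..\<beta>} \<theta>"
  proof eventually_elim
    case (elim \<theta>)
    show ?case
    proof (cases "0 < \<theta> \<and> \<theta> < pi/2")
      case True
      then show ?thesis using elim by (auto simp: c_iff s_iff indicator_def)
    next
      case False
      with elim range have "\<not> (\<alpha> \<le> \<theta> \<and> \<theta> \<le> \<beta>)" by auto
      with False show ?thesis by (auto simp: indicator_def)
    qed
  qed
  then have "?L = (\<integral>\<^sup>+\<theta>. ennreal (a * sin \<theta> + b * cos \<theta> - 2 * t * cos \<theta> * sin \<theta>)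
      * indicator {\<alpha>..\<beta>} \<theta> \<partial>lborel)"
    by (rule nn_integral_cong_AE)
  also have "\<dots> = ennreal ((- a * cos \<beta> + b * sin \<beta> - t * (sin \<beta>)\<^sup>2) - (- a * cos \<alpha> + b * sin \<alpha> - t * (sin \<alpha>)\<^sup>2))"
  proof (rule nn_integral_FTC_Icc[where F = "\<lambda>\<theta>. - a * cos \<theta> + b * sin \<theta> - t * (sin \<theta>)\<^sup>2"])
    fix \<theta> assume \<theta>: "\<theta> \<in> {\<alpha>..\<beta>}"
    show "((\<lambda>\<theta>. - a * cos \<theta> + b * sin \<theta> - t * (sin \<theta>)\<^sup>2) has_real_derivative
        a * sin \<theta> + b * cos \<theta> - 2 * t * cos \<theta> * sin \<theta>) (at \<theta>)"
      by (auto intro!: derivative_eq_intros)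
    have cs: "0 \<le> cos \<theta>" "0 \<le> sin \<theta>"
      using \<theta> range by (auto intro!: cos_ge_zero sin_ge_zero)
    have "cos \<theta> \<le> c1"
      using \<theta> range unfolding cs1(1)[symmetric] by (subst cos_mono_le_eq) auto
    then have "t * cos \<theta> \<le> max a t * c1"
      using t c1 cs by (intro mult_mono) auto
    then have tc: "t * cos \<theta> \<le> a"
      using ab by (simp add: c1_def)
    have "sin \<theta> \<le> s2"
      using \<theta> range unfolding cs2(1)[symmetric] by (subst sin_mono_le_eq) auto
    then have "t * sin \<theta> \<le> max b t * s2"
      using t s2 cs by (intro mult_mono) auto
    then have ts: "t * sin \<theta> \<le> b"
      using ab by (simp add: s2_def)
    have "t * cos \<theta> * sin \<theta> \<le> a * sin \<theta>" "t * sin \<theta> * cos \<theta> \<le> b * cos \<theta>"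
      using mult_right_mono[OF tc cs(2)] mult_right_mono[OF ts cs(1)] by auto
    then show "0 \<le> a * sin \<theta> + b * cos \<theta> - 2 * t * cos \<theta> * sin \<theta>"
      by (simp add: mult.assoc mult.commute[of "sin \<theta>"])
  qed (use le in auto)
  also have "(- a * cos \<beta> + b * sin \<beta> - t * (sin \<beta>)\<^sup>2) - (- a * cos \<alpha> + b * sin \<alpha> - t * (sin \<alpha>)\<^sup>2)
    = chord_tail a b t"
  proof -
    \<comment> \<open>\<open>sin (arccos (x / t))\<close> and \<open>cos (arcsin (x / t))\<close> with the cap taken into account.\<close>
    have root: "sqrt (1 - (x / max x t)\<^sup>2) = sqrt (max 0 (t\<^sup>2 - x\<^sup>2)) / max x t" if "0 < x" for x
    proof (cases "t \<le> x")
      case True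
      with t(1) that have "t\<^sup>2 \<le> x\<^sup>2" by (simp add: power_mono)
      with True that show ?thesis by (simp add: max_def)
    next
      case False
      then have "x\<^sup>2 \<le> t\<^sup>2" using that by (simp add: power_mono)
      moreover have "1 - (x / t)\<^sup>2 = (t\<^sup>2 - x\<^sup>2) / t\<^sup>2"
        using False that by (simp add: field_simps)
      ultimately show ?thesis
        using False that by (simp add: max_def real_sqrt_divide)
    qed
    have sq: "(sin \<alpha>)\<^sup>2 = 1 - c1\<^sup>2" "(sin \<beta>)\<^sup>2 = s2\<^sup>2"
      using c1 by (simp_all add: sin_squared_eq cs1(1) cs2(1))
    have roots: "sin \<alpha> = sqrt (max 0 (t\<^sup>2 - a\<^sup>2)) / max a t" "cos \<beta> = sqrt (max 0 (t\<^sup>2 - b\<^sup>2)) / max b t"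
      using root[of a] root[of b] ab by (simp_all add: cs1(2) cs2(2) c1_def s2_def)
    consider "t \<le> a" | "a < t" "t \<le> b" | "b < t" by linarith
    then show ?thesis
    proof cases
      case 1
      then have "t\<^sup>2 \<le> a\<^sup>2" "t\<^sup>2 \<le> b\<^sup>2" using t ab by (simp_all add: power_mono)
      then show ?thesis
        unfolding sq unfolding roots cs1(1) cs2(1) chord_tail_def c1_def s2_def
        using 1 ab by (simp add: max_absorb1)
    next
      case 2
      then have "t\<^sup>2 \<le> b\<^sup>2" using t by (simp add: power_mono)
      then show ?thesis
        unfolding sq unfolding roots cs1(1) cs2(1) chord_tail_def c1_def s2_def
        using 2 ab by (simp add: max_absorb1 max_absorb2 field_simps power2_eq_square)
    next
      case 3
      then show ?thesis
        unfolding sq unfolding roots cs1(1) cs2(1) chord_tail_def c1_def s2_def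
        using ab by (simp add: max_absorb2 field_simps power2_eq_square)
    qed
  qed
  finally show ?thesis .
qed

end


section \<open>The density as the derivative of the tail\<close>

definition chord_density :: "real \<Rightarrow> real \<Rightarrow> real \<Rightarrow> real" where
  "chord_density a b t =
    (if 0 < t \<and> t < sqrt (a\<^sup>2 + b\<^sup>2)
     then 1 / (a + b) *
       (if t < a \<and> t < b then 1
        else if a < t \<and> t < b then a\<^sup>2 * b / (t\<^sup>2 * sqrt (t\<^sup>2 - a\<^sup>2))
        else if t > a \<and> t > b then
          - 1 + 1 / t\<^sup>2 * (a\<^sup>2 * b / sqrt (t\<^sup>2 - a\<^sup>2) + a * b\<^sup>2 / sqrt (t\<^sup>2 - b\<^sup>2))
        else 0)
     else 0)"

lemma chord_density_measurable: "chord_density a b \<in> borel_measurable borel"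
  unfolding chord_density_def[abs_def] by measurable

lemma DERIV_sqrt_over:
  fixes x t :: real
  assumes "0 < x" "x < t"
  shows "((\<lambda>t. sqrt (t\<^sup>2 - x\<^sup>2) / t) has_real_derivative x\<^sup>2 / (t\<^sup>2 * sqrt (t\<^sup>2 - x\<^sup>2))) (at t)"
proof -
  define r where "r = sqrt (t\<^sup>2 - x\<^sup>2)"
  have pos: "0 < t\<^sup>2 - x\<^sup>2" using assms by (simp add: power_strict_mono)
  then have r: "0 < r" "r\<^sup>2 = t\<^sup>2 - x\<^sup>2" by (simp_all add: r_def)
  have "((\<lambda>t. t\<^sup>2 - x\<^sup>2) has_real_derivative 2 * t) (at t)"
    by (auto intro!: derivative_eq_intros)
  then have "((\<lambda>t. sqrt (t\<^sup>2 - x\<^sup>2)) has_real_derivative inverse r / 2 * (2 * t)) (at t)"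
    unfolding r_def by (rule DERIV_chain2[where f = sqrt and g = "\<lambda>t. t\<^sup>2 - x\<^sup>2", OF DERIV_real_sqrt[OF pos]])
  then have "((\<lambda>t. sqrt (t\<^sup>2 - x\<^sup>2) / t) has_real_derivative
      (inverse r / 2 * (2 * t) * t - sqrt (t\<^sup>2 - x\<^sup>2) * 1) / (t * t)) (at t)"
    using assms by (intro DERIV_divide) auto
  moreover have "(inverse r / 2 * (2 * t) * t - sqrt (t\<^sup>2 - x\<^sup>2) * 1) / (t * t) = x\<^sup>2 / (t\<^sup>2 * r)"
  proof -
    have "inverse r / 2 * (2 * t) * t - r * 1 = (t\<^sup>2 - r\<^sup>2) / r"
      using r(1) by (simp add: field_simps power2_eq_square)
    also have "t\<^sup>2 - r\<^sup>2 = x\<^sup>2" using r(2) by simp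
    finally show ?thesis unfolding r_def[symmetric] by (simp add: power2_eq_square mult.commute)
  qed
  ultimately show ?thesis by (simp add: r_def)
qed

context
  fixes a b :: real
  assumes ab: "0 < a" "a \<le> b"
begin

text \<open>
  Only the case that \<open>t\<close> lies between \<open>b\<close> and the diagonal is not obvious.  There
  \<open>sqrt (t\<^sup>2 - a\<^sup>2) \<le> b\<close> and \<open>sqrt (t\<^sup>2 - b\<^sup>2) \<le> a\<close>; hence the bracket is at least
  \<open>a\<^sup>2 + b\<^sup>2\<close>, which exceeds \<open>t\<^sup>2\<close>.
\<close>

lemma chord_density_nonneg: "0 \<le> chord_density a b t"
proof -
  let ?r = "\<lambda>x. sqrt (t\<^sup>2 - x\<^sup>2)"
  have "1 \<le> 1 / t\<^sup>2 * (a\<^sup>2 * b / ?r a + a * b\<^sup>2 / ?r b)" if t: "b < t" "t < sqrt (a\<^sup>2 + b\<^sup>2)"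
  proof -
    have t0: "0 < t" using t ab by simp
    then have t2: "t\<^sup>2 \<le> a\<^sup>2 + b\<^sup>2"
      using power_mono[of t "sqrt (a\<^sup>2 + b\<^sup>2)" 2] t(2) by simp
    have "0 < ?r a" "0 < ?r b"
      using t ab by (simp_all add: power_strict_mono)
    moreover have "?r a \<le> b" "?r b \<le> a"
      using t2 ab by (auto intro!: real_le_lsqrt)
    ultimately have "a\<^sup>2 * 1 \<le> a\<^sup>2 * (b / ?r a)" "b\<^sup>2 * 1 \<le> b\<^sup>2 * (a / ?r b)"
      by (intro mult_left_mono; simp)+
    then have "t\<^sup>2 \<le> a\<^sup>2 * b / ?r a + a * b\<^sup>2 / ?r b"
      using t2 by (simp add: mult.commute)
    then show ?thesis using t0 by simp
  qed
  moreover have "0 \<le> a\<^sup>2 * b / (t\<^sup>2 * ?r a)" if "a < t"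
    using that ab by (intro divide_nonneg_nonneg mult_nonneg_nonneg) (auto intro!: power_mono)
  ultimately show ?thesis
    unfolding chord_density_def using ab by auto
qed

text \<open>
  Off \<open>a\<close> and \<open>b\<close> each \<open>max\<close> in \<open>chord_tail\<close> selects the same argument in a whole
  neighbourhood, which leaves a linear combination of \<open>t\<close> and \<open>sqrt (t\<^sup>2 - x\<^sup>2) / t\<close> for
  \<open>x\<close> equal to \<open>a\<close> or \<open>b\<close>, up to a constant.
\<close>

lemma chord_tail_derivative:
  assumes t: "0 < t" "t < sqrt (a\<^sup>2 + b\<^sup>2)" "t \<noteq> a" "t \<noteq> b"
  shows "(chord_tail a b has_real_derivative - ((a + b) * chord_density a b t)) (at t)"
proof -
  have sum: "(a + b) * (1 / (a + b) * x) = x" for x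
    using ab by simp
  consider "t < a" | "a < t" "t < b" | "b < t" using t by linarith
  then show ?thesis
  proof cases
    case 1
    have eq: "a + b - s = chord_tail a b s" if "s \<in> {0<..<a}" for s
    proof -
      have "s\<^sup>2 \<le> a\<^sup>2" "s\<^sup>2 \<le> b\<^sup>2" using that ab by (simp_all add: power_mono)
      then show ?thesis using that ab by (simp add: chord_tail_def max_absorb1)
    qed
    have "((\<lambda>s. a + b - s) has_real_derivative - 1) (at t)"
      by (auto intro!: derivative_eq_intros)
    then have "(chord_tail a b has_real_derivative - 1) (at t)"
      by (rule has_field_derivative_transform_within_open[where S = "{0<..<a}"]) (use 1 t eq in auto)
    moreover have "(a + b) * chord_density a b t = 1"
      unfolding chord_density_def using 1 t ab by simp
    ultimately show ?thesis by simp
  next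
    case 2
    have eq: "b - b * (sqrt (s\<^sup>2 - a\<^sup>2) / s) = chord_tail a b s" if "s \<in> {a<..<b}" for s
    proof -
      have "s\<^sup>2 \<le> b\<^sup>2" "a\<^sup>2 \<le> s\<^sup>2" using that ab by (simp_all add: power_mono)
      then show ?thesis using that ab by (simp add: chord_tail_def max_absorb1 max_absorb2)
    qed
    have "((\<lambda>s. b - b * (sqrt (s\<^sup>2 - a\<^sup>2) / s)) has_real_derivative 0 - b * (a\<^sup>2 / (t\<^sup>2 * sqrt (t\<^sup>2 - a\<^sup>2)))) (at t)"
      by (intro DERIV_diff DERIV_const DERIV_cmult DERIV_sqrt_over ab(1) 2)
    then have "(chord_tail a b has_real_derivative 0 - b * (a\<^sup>2 / (t\<^sup>2 * sqrt (t\<^sup>2 - a\<^sup>2)))) (at t)"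
      by (rule has_field_derivative_transform_within_open[where S = "{a<..<b}"]) (use 2 eq in auto)
    moreover have "(a + b) * chord_density a b t = b * (a\<^sup>2 / (t\<^sup>2 * sqrt (t\<^sup>2 - a\<^sup>2)))"
      unfolding chord_density_def using 2 t ab by (simp add: sum mult.commute)
    ultimately show ?thesis by simp
  next
    case 3
    have eq: "s - (b * (sqrt (s\<^sup>2 - a\<^sup>2) / s) + a * (sqrt (s\<^sup>2 - b\<^sup>2) / s)) = chord_tail a b s" if "s \<in> {b<..}" for s
    proof -
      have "b\<^sup>2 \<le> s\<^sup>2" "a\<^sup>2 \<le> s\<^sup>2" using that ab by (simp_all add: power_mono)
      then show ?thesis using that ab by (simp add: chord_tail_def max_absorb2 add_divide_distrib)
    qed
    have "((\<lambda>s. s - (b * (sqrt (s\<^sup>2 - a\<^sup>2) / s) + a * (sqrt (s\<^sup>2 - b\<^sup>2) / s))) has_real_derivative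
        1 - (b * (a\<^sup>2 / (t\<^sup>2 * sqrt (t\<^sup>2 - a\<^sup>2))) + a * (b\<^sup>2 / (t\<^sup>2 * sqrt (t\<^sup>2 - b\<^sup>2))))) (at t)"
      using 3 ab by (intro DERIV_diff DERIV_add DERIV_ident DERIV_cmult DERIV_sqrt_over) auto
    then have "(chord_tail a b has_real_derivative
        1 - (b * (a\<^sup>2 / (t\<^sup>2 * sqrt (t\<^sup>2 - a\<^sup>2))) + a * (b\<^sup>2 / (t\<^sup>2 * sqrt (t\<^sup>2 - b\<^sup>2))))) (at t)"
      by (rule has_field_derivative_transform_within_open[where S = "{b<..}"]) (use 3 eq in auto)
    moreover have "(a + b) * chord_density a b t =
        - 1 + (b * (a\<^sup>2 / (t\<^sup>2 * sqrt (t\<^sup>2 - a\<^sup>2))) + a * (b\<^sup>2 / (t\<^sup>2 * sqrt (t\<^sup>2 - b\<^sup>2))))"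
      unfolding chord_density_def using 3 t ab by (simp add: sum mult.commute distrib_left)
    ultimately show ?thesis by simp
  qed
qed

text \<open>
  The density is unbounded to the right of \<open>a\<close> and of \<open>b\<close>, but its antiderivative is
  continuous there, so the fundamental theorem applies with these two points as exceptions.
\<close>

lemma chord_density_integral:
  assumes t: "0 \<le> t" "t \<le> sqrt (a\<^sup>2 + b\<^sup>2)"
  shows "(\<integral>\<^sup>+s. ennreal (chord_density a b s) * indicator {t..sqrt (a\<^sup>2 + b\<^sup>2)} s \<partial>lborel) =
    ennreal (chord_tail a b t / (a + b))"
proof (rule nn_integral_has_integral_lebesgue')
  let ?d = "sqrt (a\<^sup>2 + b\<^sup>2)"
  have "(chord_density a b has_integral - chord_tail a b ?d / (a + b) - - chord_tail a b t / (a + b)) {t..?d}"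
  proof (rule fundamental_theorem_of_calculus_interior_strong[where S = "{a, b}"])
    fix s assume s: "s \<in> {t<..<?d} - {a, b}"
    have "((\<lambda>s. - chord_tail a b s / (a + b)) has_real_derivative
        - (- ((a + b) * chord_density a b s)) / (a + b)) (at s)"
      using s t by (intro DERIV_cdivide DERIV_minus chord_tail_derivative) auto
    then show "((\<lambda>s. - chord_tail a b s / (a + b)) has_vector_derivative chord_density a b s) (at s)"
      using ab by (simp add: has_real_derivative_iff_has_vector_derivative)
  next
    show "continuous_on {t..?d} (\<lambda>s. - chord_tail a b s / (a + b))"
      unfolding chord_tail_def using ab by (auto intro!: continuous_intros)
  qed (use t in auto)
  then show "(chord_density a b has_integral chord_tail a b t / (a + b)) {t..?d}"
    by (simp add: chord_tail_diagonal[OF ab])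
qed (rule chord_density_nonneg)

text \<open>
  Chord lengths lie between \<open>0\<close> and the diagonal, so a tail probability does not change when its
  threshold is moved into that range.  This covers all real thresholds by one formula.
\<close>

definition clamp_to_diagonal :: "real \<Rightarrow> real" where
  "clamp_to_diagonal t = max 0 (min t (sqrt (a\<^sup>2 + b\<^sup>2)))"

lemma emeasure_chord_density_gt:
  "emeasure (density lborel (\<lambda>t. ennreal (chord_density a b t))) {t<..} = ennreal (chord_tail a b (clamp_to_diagonal t) / (a + b))"
proof -
  let ?d = "sqrt (a\<^sup>2 + b\<^sup>2)"
  have d: "0 \<le> ?d" by simp
  have [measurable]: "chord_density a b \<in> borel_measurable borel"
    by (rule chord_density_measurable)
  have "emeasure (density lborel (\<lambda>t. ennreal (chord_density a b t))) {t<..} =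
      (\<integral>\<^sup>+s. ennreal (chord_density a b s) * indicator {t<..} s \<partial>lborel)"
    by (intro emeasure_density) auto
  also have "\<dots> = (\<integral>\<^sup>+s. ennreal (chord_density a b s) * indicator {clamp_to_diagonal t..?d} s \<partial>lborel)"
  proof (rule nn_integral_cong_AE)
    have "AE s in lborel. s \<noteq> t" by (rule AE_lborel_singleton)
    then show "AE s in lborel. ennreal (chord_density a b s) * indicator {t<..} s =
        ennreal (chord_density a b s) * indicator {clamp_to_diagonal t..?d} s"
    proof eventually_elim
      case (elim s)
      show ?case
      proof (cases "0 < s \<and> s < ?d")
        case True
        then have "t < s \<longleftrightarrow> clamp_to_diagonal t \<le> s"
          using elim by (auto simp: clamp_to_diagonal_def)
        with True show ?thesis by (simp add: indicator_def)
      next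
        case False
        then have "chord_density a b s = 0" unfolding chord_density_def by (rule if_not_P)
        then show ?thesis by simp
      qed
    qed
  qed
  also have "\<dots> = ennreal (chord_tail a b (clamp_to_diagonal t) / (a + b))"
    using d by (intro chord_density_integral) (auto simp: clamp_to_diagonal_def)
  finally show ?thesis .
qed

section \<open>The distribution of the chord length\<close>

lemma emeasure_line_measure_long_chords:
  assumes "0 \<le> t"
  shows "emeasure line_measure {l. t < chord_length (rectangle a b) l} = 4 * ennreal (chord_tail a b (clamp_to_diagonal t))"
proof -
  let ?d = "sqrt (a\<^sup>2 + b\<^sup>2)"
  have b: "0 < b" using ab by simp
  have "closed (rectangle a b)" by (simp add: rectangle_def closed_Times)
  then have m: "{l. t < chord_length (rectangle a b) l} \<in> sets borel"
    using borel_measurable_less[OF borel_measurable_const measurable_chord_length, of "rectangle a b" t]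
    by (simp add: borel_closed)
  define h where "h x y = (if t * x < a \<and> t * y < b then ennreal (a * y + b * x - 2 * t * x * y) else 0)" for x y :: real
  define g where "g \<theta> = h \<bar>cos \<theta>\<bar> \<bar>sin \<theta>\<bar>" for \<theta>
  have [measurable]: "g \<in> borel_measurable borel"
    unfolding g_def[abs_def] h_def by measurable
  have "AE \<theta> in lborel. emeasure lborel {p. polar_line \<theta> p \<in> {l. t < chord_length (rectangle a b) l}} = g \<theta>"
    using cos_sin_nonzero_ae
  proof eventually_elim
    case (elim \<theta>)
    then show ?case
      unfolding mem_Collect_eq g_def h_def
      by (intro emeasure_long_chords_slice ab(1) b assms) simp_all
  qed
  then have "emeasure line_measure {l. t < chord_length (rectangle a b) l} = (\<integral>\<^sup>+\<theta>. g \<theta> * indicator {0..<2*pi} \<theta> \<partial>lborel)"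
    unfolding emeasure_line_measure_polar[OF m]
    by (intro nn_integral_cong_AE) (auto elim!: eventually_mono)
  also have "\<dots> = 4 * (\<integral>\<^sup>+\<theta>. g \<theta> * indicator {0<..<pi/2} \<theta> \<partial>lborel)"
  proof (rule nn_integral_circle_eq_quadrant)
    show "g (pi - \<theta>) = g \<theta>" "g (2 * pi - \<theta>) = g \<theta>" for \<theta>
      by (simp_all add: g_def)
  qed measurable
  also have "(\<integral>\<^sup>+\<theta>. g \<theta> * indicator {0<..<pi/2} \<theta> \<partial>lborel) =
      (\<integral>\<^sup>+\<theta>. h (cos \<theta>) (sin \<theta>) * indicator {0<..<pi/2} \<theta> \<partial>lborel)"
  proof (intro nn_integral_cong)
    fix \<theta> :: real
    show "g \<theta> * indicator {0<..<pi/2} \<theta> = h (cos \<theta>) (sin \<theta>) * indicator {0<..<pi/2} \<theta>"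
    proof (cases "0 < \<theta> \<and> \<theta> < pi/2")
      case True
      then have "0 < cos \<theta>" "0 < sin \<theta>" by (auto simp: cos_gt_zero sin_gt_zero)
      then show ?thesis by (simp add: g_def)
    qed (auto simp: indicator_def)
  qed
  also have "\<dots> = ennreal (chord_tail a b (clamp_to_diagonal t))"
  proof (cases "t \<le> ?d")
    case True
    then have "clamp_to_diagonal t = t" using assms by (simp add: clamp_to_diagonal_def)
    then show ?thesis unfolding h_def using quadrant_integral[OF ab assms True] by simp
  next
    case False
    have zero: "h (cos \<theta>) (sin \<theta>) * indicator {0<..<pi/2} \<theta> = 0" for \<theta>
    proof (cases "0 < \<theta> \<and> \<theta> < pi/2")
      case True
      then have cs: "0 < cos \<theta>" "0 < sin \<theta>" by (auto simp: cos_gt_zero sin_gt_zero)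
      \<comment> \<open>No chord is longer than the diagonal: squaring and adding would give \<open>t\<^sup>2 < a\<^sup>2 + b\<^sup>2\<close>.\<close>
      have "\<not> (t * cos \<theta> < a \<and> t * sin \<theta> < b)"
      proof
        assume "t * cos \<theta> < a \<and> t * sin \<theta> < b"
        then have "(t * cos \<theta>)\<^sup>2 < a\<^sup>2" "(t * sin \<theta>)\<^sup>2 < b\<^sup>2"
          using cs assms by (auto intro!: power_strict_mono)
        then have "t\<^sup>2 * ((cos \<theta>)\<^sup>2 + (sin \<theta>)\<^sup>2) < a\<^sup>2 + b\<^sup>2"
          unfolding power_mult_distrib distrib_left by linarith
        then have "t\<^sup>2 < a\<^sup>2 + b\<^sup>2" by simp
        with False show False by (simp add: real_less_rsqrt less_imp_le)
      qed
      then show ?thesis by (simp only: h_def if_False mult_zero_left)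
    qed (simp add: indicator_def)
    have "clamp_to_diagonal t = ?d" using False assms by (simp add: clamp_to_diagonal_def)
    then show ?thesis unfolding zero by (simp add: chord_tail_diagonal[OF ab])
  qed
  finally show ?thesis .
qed

text \<open>
  The lines that touch the rectangle in a single point have measure zero, so the threshold \<open>0\<close> of
  the previous lemma gives the total mass.
\<close>

lemma emeasure_lines_meeting_rectangle:
  "emeasure line_measure (lines_meeting (rectangle a b)) = 4 * ennreal (a + b)"
proof -
  let ?R = "rectangle a b"
  have b: "0 < b" using ab by simp
  have "compact ?R" by (simp add: rectangle_def compact_Times)
  then have meet: "lines_meeting ?R \<in> sets borel" and R: "?R \<in> sets borel"
    by (simp_all add: sets_lines_meeting borel_compact)
  have chord: "{l. 0 < chord_length ?R l} \<in> sets borel"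
    using borel_measurable_less[OF borel_measurable_const measurable_chord_length[OF R], of 0] by simp
  have "AE \<theta> in lborel. emeasure lborel {p. polar_line \<theta> p \<in> lines_meeting ?R} =
      emeasure lborel {p. polar_line \<theta> p \<in> {l. 0 < chord_length ?R l}}"
    using cos_sin_nonzero_ae
  proof eventually_elim
    case (elim \<theta>)
    then show ?case
      unfolding mem_Collect_eq
      by (subst emeasure_lines_meeting_slice emeasure_long_chords_slice; simp add: ab b)+
  qed
  then have "emeasure line_measure (lines_meeting ?R) = emeasure line_measure {l. 0 < chord_length ?R l}"
    unfolding emeasure_line_measure_polar[OF meet] emeasure_line_measure_polar[OF chord]
    by (intro nn_integral_cong_AE) (auto elim!: eventually_mono)
  also have "\<dots> = 4 * ennreal (chord_tail a b (clamp_to_diagonal 0))"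
    by (rule emeasure_line_measure_long_chords) simp
  also have "clamp_to_diagonal 0 = 0" by (simp add: clamp_to_diagonal_def)
  finally show ?thesis by (simp add: chord_tail_0[OF ab])
qed

lemma emeasure_random_line_long_chords:
  "emeasure (random_line (rectangle a b)) {l. t < chord_length (rectangle a b) l} = ennreal (chord_tail a b (clamp_to_diagonal t) / (a + b))"
proof -
  let ?R = "rectangle a b" and ?T = "chord_tail a b (clamp_to_diagonal t)"
  have "compact ?R" by (simp add: rectangle_def compact_Times)
  then have meet: "lines_meeting ?R \<in> sets borel" and R: "?R \<in> sets borel"
    by (simp_all add: sets_lines_meeting borel_compact)
  have chord: "{l. t < chord_length ?R l} \<in> sets borel"
    using borel_measurable_less[OF borel_measurable_const measurable_chord_length[OF R], of t] by simp
  have sets: "sets line_measure = sets borel" by (simp add: line_measure_def)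
  have "emeasure line_measure (lines_meeting ?R \<inter> {l. t < chord_length ?R l}) = 4 * ennreal ?T"
  proof (cases "0 \<le> t")
    case True
    then have "polar_line \<theta> p \<in> lines_meeting ?R \<inter> {l. t < chord_length ?R l} \<longleftrightarrow>
        polar_line \<theta> p \<in> {l. t < chord_length ?R l}" for \<theta> p
      using lines_meeting_if_chord_pos[OF polar_line_in_directed_lines[of \<theta> p], of ?R] by auto
    then have "emeasure line_measure (lines_meeting ?R \<inter> {l. t < chord_length ?R l}) =
        emeasure line_measure {l. t < chord_length ?R l}"
      by (simp only: emeasure_line_measure_polar[OF sets.Int[OF meet chord]] emeasure_line_measure_polar[OF chord])
    then show ?thesis
      using emeasure_line_measure_long_chords[OF True] by simp
  next
    case False
    then have "t < chord_length ?R l" for l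
      by (simp add: chord_length_def less_le_trans[OF _ measure_nonneg])
    moreover have "clamp_to_diagonal t = 0" using False by (simp add: clamp_to_diagonal_def)
    ultimately show ?thesis
      by (simp add: emeasure_lines_meeting_rectangle chord_tail_0[OF ab])
  qed
  then have "emeasure (random_line ?R) {l. t < chord_length ?R l} = 4 * ennreal ?T / (4 * ennreal (a + b))"
    unfolding random_line_def
    by (subst emeasure_uniform_measure) (simp_all only: sets meet chord emeasure_lines_meeting_rectangle)
  also have "\<dots> = ennreal (?T / (a + b))"
  proof (cases "0 \<le> ?T")
    case True
    have "4 * ennreal ?T / (4 * ennreal (a + b)) = ennreal (4 * ?T) / ennreal (4 * (a + b))"
      using ab by (simp add: ennreal_mult')
    also have "\<dots> = ennreal (?T / (a + b))"
      using True ab by (subst divide_ennreal) (simp_all del: distrib_left_numeral)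
    finally show ?thesis .
  next
    case False
    then show ?thesis using ab by (simp add: ennreal_neg divide_nonpos_pos)
  qed
  finally show ?thesis .
qed

text \<open>
  Finite measures on the line are determined by their values on the half-lines \<open>{t<..}\<close>.
\<close>

lemma distributed_chord_length:
  "distributed (random_line (rectangle a b)) lborel (chord_length (rectangle a b))
    (\<lambda>t. ennreal (chord_density a b t))"
  unfolding distributed_def
proof (intro conjI)
  let ?R = "rectangle a b"
  have R: "?R \<in> sets borel"
    by (simp add: rectangle_def closed_Times borel_closed)
  have [measurable_cong]: "sets (random_line ?R) = sets borel"
    by (simp add: random_line_def line_measure_def)
  show chord [measurable]: "chord_length ?R \<in> random_line ?R \<rightarrow>\<^sub>M lborel"
    using measurable_chord_length[OF R] by measurable
  show "(\<lambda>t. ennreal (chord_density a b t)) \<in> borel_measurable lborel"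
    using chord_density_measurable by measurable
  show "distr (random_line ?R) lborel (chord_length ?R) = density lborel (\<lambda>t. ennreal (chord_density a b t))"
  proof (rule measure_eqI_lessThan)
    fix t :: real
    have space: "space (random_line ?R) = UNIV"
      by (simp add: random_line_def line_measure_def)
    have "emeasure (distr (random_line ?R) lborel (chord_length ?R)) {t<..} =
        emeasure (random_line ?R) {l. t < chord_length ?R l}"
      by (simp add: emeasure_distr[OF chord] space vimage_def)
    then have tail: "emeasure (distr (random_line ?R) lborel (chord_length ?R)) {t<..} =
        ennreal (chord_tail a b (clamp_to_diagonal t) / (a + b))"
      unfolding emeasure_random_line_long_chords .
    then show "emeasure (distr (random_line ?R) lborel (chord_length ?R)) {t<..} < \<infinity>"
      by simp
    show "emeasure (distr (random_line ?R) lborel (chord_length ?R)) {t<..} =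
        emeasure (density lborel (\<lambda>t. ennreal (chord_density a b t))) {t<..}"
      unfolding tail emeasure_chord_density_gt ..
  qed simp_all
qed

end

theorem theorem3:
  fixes a b :: real
  assumes "0 < a" and "a \<le> b"
  shows "distributed (random_line (rectangle a b)) lborel (chord_length (rectangle a b))
    (\<lambda>t. ennreal
      (if 0 < t \<and> t < sqrt (a\<^sup>2 + b\<^sup>2)
       then 1 / (a + b) *
         (if t < a \<and> t < b then 1
          else if a < t \<and> t < b then a\<^sup>2 * b / (t\<^sup>2 * sqrt (t\<^sup>2 - a\<^sup>2))
          else if t > a \<and> t > b then
            - 1 + 1 / t\<^sup>2 * (a\<^sup>2 * b / sqrt (t\<^sup>2 - a\<^sup>2) + a * b\<^sup>2 / sqrt (t\<^sup>2 - b\<^sup>2))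
          else 0)
       else 0))"
  using distributed_chord_length[OF assms] unfolding chord_density_def .

end
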